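(* The Mathieu moonshine picture $\mathfrak{M}_{24}$ (resp. the extended Mathieu moonshine picture $\mathfrak{M}_{24}^e$) is the full subgraph of Conway's big picture $\mathfrak{P}$ on exactly $93$ (resp. $94$) classes. Among these there are exactly $35$ number classes $C$. The remaining classes are number-like classes $M\frac{g}{h}$ with $h>1$, viewed as primitive $h$-th roots of unity centered at the number class $C=M\cdot h$. The following list gives all number classes $C$ and, for each, the set of $h$ such that the primitive $h$-th roots of unity centered at $C$ (that is, the classes $\frac{C}{h}\frac{g}{h}$ with $0\le g<h$, $(g,h)=1$) belong to the picture; an entry in parentheses means that these roots belong to $\mathfrak{M}_{24}^e$ but not to $\mathfrak{M}_{24}$. $h\in\{1\}$: $C=1,5,7,9,11,15,22,23,28,30,32,40,46,63,126,288$. $h\in\{1,2\}$: $C=2,10,16,18,20,144$. $h\in\{1,(2)\}$: $C=14$. $h\in\{1,3\}$: $C=3,21,42,96$. $h\in\{1,2,4\}$: $C=4,8,36,72$. $h\in\{1,2,3,6\}$: $C=6,48$. $h\in\{1,2,3,4,6,12\}$: $C=12,24$.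
   Context: Classes. The vertices of Conway's big picture $\mathfrak{P}$ are the pairs $X=(M,\frac{g}{h})\in\mathbb{Q}_{>0}\times\mathbb{Q}/\mathbb{Z}$, with $\frac{g}{h}$ in lowest terms and $0\le g<h$ (for $h=1$, $g=0$), with associated matrix $\alpha_X=\begin{bmatrix} M & g/h\\ 0&1\end{bmatrix}$. The hyper-distance is $\delta(X,Y)=\det(a_{XY}\alpha_X\alpha_Y^{-1})$, where $a_{XY}$ is the smallest positive rational such that $a_{XY}\alpha_X\alpha_Y^{-1}$ has integer entries; there is an edge between $X$ and $Y$ iff $\delta(X,Y)$ is a prime number. The class is number-like, written $M\frac{g}{h}$, if $M$ is a positive integer, and a number class, written $M$, if moreover $g=0$ (so $h=1$). Serpents and snakes. For $h$ a divisor of $24$ and of $n$, put $N=hn$. The $(n|h)$-serpent is the full subgraph of $\mathfrak{P}$ on the number-like classes $M\frac{g}{k}$ (with $0\le g<k$, $(g,k)=1$) such that $k\mid h$ and $M\mid \frac{N}{k^2}$. The $(N|1)$-snake is the full subgraph on the number-like classes $M\frac{g}{k}$ such that $k\mid 24$, $k^2\mid N$ and $M\mid\frac{N}{k^2}$. Mathieu moonshine pairs. The genus zero groups $n|h+e,f,\dots$ ($h$ omitted if $h=1$) attached to the conjugacy classes of the Mathieu group $M_{24}$ are: $1A$: $2-$; $2A$: $4-$; $2B$: $4|2-$; $3A$: $6+3$; $3B$: $6|3$; $4A$: $8|2-$; $4B$: $8-$; $4C$: $8|4-$; $5A$: $10+5$; $6A$: $12+3$; $6B$: $12|6-$; $7AB$: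 $14+7$; $8A$: $16-$; $10A$: $20|2+5$; $11A$: $22+11$; $12A$: $24|2+3$; $12B$: $24|12-$; $14AB$: $28+7$; $15AB$: $30+3,5,15$; $21AB$: $42|3+7$; $23AB$: $46+23$. So the pairs $(n,h)$ are $(2,1),(4,1),(4,2),(6,1),(6,3),(8,1),(8,2),(8,4),(10,1),(12,1),(12,6),(14,1),(16,1),(20,2),(22,1),(24,2),(24,12),(28,1),(30,1),(42,3),(46,1)$. The Mathieu moonshine picture $\mathfrak{M}_{24}$ is the full subgraph of $\mathfrak{P}$ on all vertices of the $(n|h)$-serpents for these pairs. The extended Mathieu moonshine picture $\mathfrak{M}_{24}^e$ is the full subgraph on all vertices of the $(N|1)$-snakes with $N=hn$ for these pairs. *)

theory Defs
  imports "HOL-Analysis.Analysis" "HOL-Computational_Algebra.Primes" "Graph_Theory.Graph_Theory"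
begin

text \<open>
  An element of \<open>\<rat>/\<int>\<close> is represented by its unique representative in \<open>[0,1)\<close>, so a class
  \<open>(M, g/h)\<close> is a pair of rationals with \<open>M > 0\<close> and second component in \<open>[0,1)\<close>.
\<close>
type_synonym lattice_class = "rat \<times> rat"

definition class_matrix :: "lattice_class \<Rightarrow> rat^2^2" where
  "class_matrix X = vector [vector [fst X, snd X], vector [0, 1]]"

definition class_quotient :: "lattice_class \<Rightarrow> lattice_class \<Rightarrow> rat^2^2" where
  "class_quotient X Y = class_matrix X ** matrix_inv (class_matrix Y)"

definition scale_matrix :: "rat \<Rightarrow> rat^2^2 \<Rightarrow> rat^2^2" where
  "scale_matrix a A = (\<chi> i j. a * A $ i $ j)"

definition integer_matrix :: "rat^2^2 \<Rightarrow> bool" where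
  "integer_matrix A \<longleftrightarrow> (\<forall>i j. A $ i $ j \<in> \<int>)"

definition clearing_factor :: "lattice_class \<Rightarrow> lattice_class \<Rightarrow> rat" where
  "clearing_factor X Y = (LEAST a. 0 < a \<and> integer_matrix (scale_matrix a (class_quotient X Y)))"

definition hyper_distance :: "lattice_class \<Rightarrow> lattice_class \<Rightarrow> rat" where
  "hyper_distance X Y = det (scale_matrix (clearing_factor X Y) (class_quotient X Y))"

definition picture_classes :: "lattice_class set" where
  "picture_classes = {(M, r). 0 < M \<and> 0 \<le> r \<and> r < 1}"

text \<open>
  The hyper-distance is symmetric, so an undirected edge is encoded, as usual for this graph
  library, by its two opposite arcs.
\<close>
definition big_picture :: "(lattice_class, lattice_class \<times> lattice_class) pre_digraph" where
  "big_picture =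
     \<lparr> verts = picture_classes,
       arcs = {(X, Y) \<in> picture_classes \<times> picture_classes.
                 \<exists>p::nat. prime p \<and> hyper_distance X Y = of_nat p},
       tail = fst, head = snd \<rparr>"

definition frac_class :: "rat \<Rightarrow> nat \<Rightarrow> nat \<Rightarrow> lattice_class" where
  "frac_class M g h = (M, of_nat g / of_nat h)"

definition number_like :: "lattice_class \<Rightarrow> bool" where
  "number_like X \<longleftrightarrow> X \<in> verts big_picture \<and> (\<exists>m::nat. 0 < m \<and> fst X = of_nat m)"

definition number_class :: "lattice_class \<Rightarrow> bool" where
  "number_class X \<longleftrightarrow> number_like X \<and> snd X = 0"

definition serpent :: "nat \<Rightarrow> nat \<Rightarrow> (lattice_class, lattice_class \<times> lattice_class) pre_digraph" where
  "serpent n h = big_picture \<restriction>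
     {frac_class (of_nat M) g k | M g k.
        0 < M \<and> g < k \<and> coprime g k \<and> k dvd h \<and> k\<^sup>2 dvd h * n \<and> M dvd (h * n) div k\<^sup>2}"

definition snake :: "nat \<Rightarrow> (lattice_class, lattice_class \<times> lattice_class) pre_digraph" where
  "snake N = big_picture \<restriction>
     {frac_class (of_nat M) g k | M g k.
        0 < M \<and> g < k \<and> coprime g k \<and> k dvd 24 \<and> k\<^sup>2 dvd N \<and> M dvd N div k\<^sup>2}"

text \<open>
  The pairs \<open>(n, h)\<close> of the groups \<open>n|h+e,f,\<dots>\<close>, for the conjugacy classes 1A, 2A, 2B, 3A, 3B,
  4A, 4B, 4C, 5A, 6A, 6B, 7AB, 8A, 10A, 11A, 12A, 12B, 14AB, 15AB, 21AB, 23AB in this order.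
\<close>
definition mathieu_pairs :: "(nat \<times> nat) set" where
  "mathieu_pairs =
     {(2,1), (4,1), (4,2), (6,1), (6,3), (8,2), (8,1), (8,4), (10,1), (12,1), (12,6), (14,1),
      (16,1), (20,2), (22,1), (24,2), (24,12), (28,1), (30,1), (42,3), (46,1)}"

definition mathieu_picture :: "(lattice_class, lattice_class \<times> lattice_class) pre_digraph" where
  "mathieu_picture = big_picture \<restriction> (\<Union>(n, h) \<in> mathieu_pairs. verts (serpent n h))"

definition extended_mathieu_picture ::
    "(lattice_class, lattice_class \<times> lattice_class) pre_digraph" where
  "extended_mathieu_picture = big_picture \<restriction> (\<Union>(n, h) \<in> mathieu_pairs. verts (snake (h * n)))"

definition primitive_roots_at :: "nat \<Rightarrow> nat \<Rightarrow> lattice_class set" where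
  "primitive_roots_at C h =
     {frac_class (of_nat C / of_nat h) g h | g. g < h \<and> coprime g h}"

definition root_orders ::
    "(lattice_class, lattice_class \<times> lattice_class) pre_digraph \<Rightarrow> nat \<Rightarrow> nat set" where
  "root_orders G C = {h. 0 < h \<and> primitive_roots_at C h \<subseteq> verts G}"

end

theory Submission
  imports Defs
begin

text \<open>
  Write a number-like class \<open>M g/k\<close> as a primitive \<open>k\<close>-th root of unity centred at \<open>C = M k\<close>. The
  conditions \<open>k\<^sup>2 dvd N\<close> and \<open>M dvd N / k\<^sup>2\<close> then become \<open>k dvd C\<close> and \<open>C k dvd N\<close>, which do not involve
  \<open>g\<close>. So each picture is the disjoint union of full sets of primitive roots over a set \<open>T\<close> of
  pairs \<open>(C, k)\<close>; it has \<open>\<Sum>(C, k) \<in> T. \<phi>(k)\<close> classes, and every claim is read off \<open>T\<close>. The two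
  index sets are computed from the 21 pairs and differ only by \<open>(14, 2)\<close>.
\<close>

section \<open>Primitive roots of unity and their pairs of centre and order\<close>

definition root_classes :: "(nat \<times> nat) set \<Rightarrow> lattice_class set" where
  "root_classes T = (\<Union>(C, k) \<in> T. primitive_roots_at C k)"

text \<open>The bound \<open>j\<close> on the orders is \<open>h\<close> for the serpent of level
  \<open>N = h * n\<close> and 24 for the snake of level \<open>N\<close>, so both are treated at
  once.\<close>

definition root_index :: "nat \<Rightarrow> nat \<Rightarrow> (nat \<times> nat) set" where
  "root_index N j = {(C, k). k dvd j \<and> k dvd C \<and> C * k dvd N}"

text \<open>After cross-multiplication each denominator divides a product and is coprime to one of
  its factors, so the two denominators divide each other. Numerator 0 is covered: coprimality then
  forces denominator 1.\<close>

lemma lowest_terms_unique: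
  fixes g h g' h' :: nat
  assumes "(of_nat g / of_nat h :: rat) = of_nat g' / of_nat h'"
    and "0 < h" "0 < h'" "coprime g h" "coprime g' h'"
  shows "g = g' \<and> h = h'"
proof -
  have "(of_nat (g * h') :: rat) = of_nat (g' * h)"
    using assms(1-3) by (simp add: frac_eq_eq)
  then have eq: "g * h' = g' * h"
    by (simp only: of_nat_eq_iff)
  have "h dvd g * h'" "h' dvd g' * h"
    using eq by (simp, metis dvd_triv_right)
  then have "h dvd h'" "h' dvd h"
    using assms(4,5) by (simp_all add: coprime_dvd_mult_right_iff coprime_commute)
  then have "h = h'"
    by (rule dvd_antisym)
  then show ?thesis
    using eq assms(2) by simp
qed

text \<open>Lowest terms recover \<open>g\<close> and the order from the second coordinate; the
  first coordinate, centre over order, then recovers the centre. Hence a single root decides whether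
  its pair lies in \<open>T\<close>.\<close>

lemma frac_class_in_root_classes_iff:
  assumes "\<forall>(C, k) \<in> T. 0 < k" "0 < h" "g < h" "coprime g h"
  shows "frac_class (of_nat C / of_nat h) g h \<in> root_classes T \<longleftrightarrow> (C, h) \<in> T"
proof
  assume "frac_class (of_nat C / of_nat h) g h \<in> root_classes T"
  then obtain C' k g' where *: "(C', k) \<in> T" "g' < k" "coprime g' k"
      "frac_class (of_nat C / of_nat h) g h = frac_class (of_nat C' / of_nat k) g' k"
    by (auto simp: root_classes_def primitive_roots_at_def)
  then have "g = g' \<and> h = k"
    using lowest_terms_unique[of g h g' k] assms by (auto simp: frac_class_def)
  with * assms(2) show "(C, h) \<in> T"
    by (simp add: frac_class_def)
next
  assume "(C, h) \<in> T"
  with assms show "frac_class (of_nat C / of_nat h) g h \<in> root_classes T"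
    by (auto simp: root_classes_def primitive_roots_at_def)
qed

text \<open>This keeps inclusions of sets of primitive roots from being vacuous. The residue is 0
  for order 1 and 1 for every larger order.\<close>

lemma primitive_root_exists:
  assumes "0 < h"
  obtains g :: nat where "g < h" "coprime g h"
proof (cases "h = 1")
  case True
  then show ?thesis using that[of 0] by simp
next
  case False
  then show ?thesis using that[of 1] assms by simp
qed

lemma primitive_roots_at_subset_root_classes_iff:
  assumes "\<forall>(C, k) \<in> T. 0 < k" "0 < h"
  shows "primitive_roots_at C h \<subseteq> root_classes T \<longleftrightarrow> (C, h) \<in> T"
proof
  assume sub: "primitive_roots_at C h \<subseteq> root_classes T"
  obtain g where "g < h" "coprime g h"
    using primitive_root_exists[OF assms(2)] .
  then show "(C, h) \<in> T"
    using sub frac_class_in_root_classes_iff[OF assms]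
    by (auto simp: primitive_roots_at_def)
next
  assume "(C, h) \<in> T"
  then show "primitive_roots_at C h \<subseteq> root_classes T"
    unfolding root_classes_def by blast
qed

text \<open>The triple of centre, order and numerator is determined by the class, again by
  uniqueness of lowest terms. Each summand is Euler's totient of \<open>k\<close>, counted on
  residues from 0 to \<open>k - 1\<close>, so order 1 contributes the residue 0.\<close>

lemma card_root_classes:
  assumes "finite T" "\<forall>(C, k) \<in> T. 0 < k"
  shows "card (root_classes T) = (\<Sum>(C, k) \<in> T. card {g \<in> {..<k}. coprime g k})"
proof -
  let ?S = "SIGMA (C, k) : T. {g \<in> {..<k}. coprime g k}"
  let ?f = "\<lambda>((C, k), g). frac_class (of_nat C / of_nat k) g k"
  have "root_classes T = ?f ` ?S"
    by (force simp: root_classes_def primitive_roots_at_def)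
  moreover have "inj_on ?f ?S"
  proof (rule inj_onI, clarsimp)
    fix C k g C' k' g'
    assume *: "(C, k) \<in> T" "(C', k') \<in> T" "coprime g k" "coprime g' k'"
      and eq: "frac_class (of_nat C / of_nat k) g k = frac_class (of_nat C' / of_nat k') g' k'"
    have "0 < k" "0 < k'"
      using * assms(2) by auto
    moreover from this have "g = g' \<and> k = k'"
      using lowest_terms_unique[of g k g' k'] * eq by (auto simp: frac_class_def)
    ultimately show "C = C' \<and> k = k' \<and> g = g'"
      using eq by (simp add: frac_class_def)
  qed
  ultimately have "card (root_classes T) = card ?S"
    by (simp add: card_image)
  also have "\<dots> = (\<Sum>(C, k) \<in> T. card {g \<in> {..<k}. coprime g k})"
    using assms(1) by (subst card_SigmaI) (auto simp: case_prod_unfold)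
  finally show ?thesis .
qed

section \<open>Serpents and snakes as sets of primitive roots\<close>

lemma root_classes_root_index:
  assumes "0 < N"
  shows "root_classes (root_index N j) =
    {frac_class (of_nat M) g k | M g k.
       0 < M \<and> g < k \<and> coprime g k \<and> k dvd j \<and> k\<^sup>2 dvd N \<and> M dvd N div k\<^sup>2}"
    (is "_ = ?S")
proof (intro equalityI subsetI)
  fix X assume "X \<in> root_classes (root_index N j)"
  then obtain M g k where X: "X = frac_class (of_nat (k * M) / of_nat k) g k"
    and *: "g < k" "coprime g k" "k dvd j" "k * M * k dvd N"
    by (auto simp: root_classes_def root_index_def primitive_roots_at_def elim!: dvdE)
  have "M * k\<^sup>2 dvd N"
    using *(4) by (simp add: power2_eq_square ac_simps)
  moreover from this have "k\<^sup>2 dvd N"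
    by (rule dvd_mult_right)
  \<comment> \<open>If \<open>M\<close> were 0, then 0 would divide the positive number
    \<open>N\<close>.\<close>
  moreover have "0 < M"
    using *(4) assms by (cases M) auto
  moreover have "X = frac_class (of_nat M) g k"
    using X *(1) by simp
  moreover have "M dvd N div k\<^sup>2"
    using calculation(1,2) *(1) by (simp add: dvd_div_iff_mult)
  ultimately show "X \<in> ?S"
    using * by blast
next
  fix X assume "X \<in> ?S"
  then obtain M g k where X: "X = frac_class (of_nat M) g k"
    and *: "g < k" "coprime g k" "k dvd j" "k\<^sup>2 dvd N" "M dvd N div k\<^sup>2"
    by blast
  have "M * k\<^sup>2 dvd N"
    using * by (simp add: dvd_div_iff_mult)
  then have "(M * k, k) \<in> root_index N j"
    using *(3) by (simp add: root_index_def power2_eq_square ac_simps)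
  moreover have "X \<in> primitive_roots_at (M * k) k"
    using X * by (auto simp: primitive_roots_at_def)
  ultimately show "X \<in> root_classes (root_index N j)"
    unfolding root_classes_def by blast
qed

section \<open>Computing the pairs that occur at a given level\<close>

text \<open>Trial division up to 16 finds every divisor of \<open>n < 17\<^sup>2\<close>, and all levels \<open>h n\<close> are at most 288.\<close>
definition divisor_list :: "nat \<Rightarrow> nat list" where
  "divisor_list n = concat (map (\<lambda>d. if d dvd n then [d, n div d] else [])
     [1, 2, 3, 4, 5, 6, 7, 8, 9, 10, 11, 12, 13, 14, 15, 16])"

text \<open>Of two complementary divisors one is below 17. The list stores each trial divisor
  together with its cofactor, so the other one is found too.\<close>

lemma dvd_imp_mem_divisor_list:
  assumes "m dvd n" "0 < n" "n < 17\<^sup>2"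
  shows "m \<in> set (divisor_list n)"
proof -
  let ?small = "[1, 2, 3, 4, 5, 6, 7, 8, 9, 10, 11, 12, 13, 14, 15, 16] :: nat list"
  have small: "d \<in> set ?small" if "0 < d" "d < 17" for d
    using that by (simp, presburger)
  have mem: "d \<in> set (divisor_list n) \<and> n div d \<in> set (divisor_list n)"
    if "d \<in> set ?small" "d dvd n" for d
    unfolding divisor_list_def set_concat set_map
    using that by (intro conjI UN_I[OF imageI[OF that(1)]]) simp_all
  obtain m' where n: "n = m * m'"
    using assms(1) by (elim dvdE)
  have pos: "0 < m" "0 < m'"
    using n assms(2) by auto
  have "m < 17 \<or> m' < 17"
  proof (rule ccontr)
    assume "\<not> (m < 17 \<or> m' < 17)"
    then have "17 * 17 \<le> m * m'"
      by (intro mult_le_mono) auto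
    then show False
      using n assms(3) by (simp add: power2_eq_square)
  qed
  then show ?thesis
  proof
    assume "m < 17"
    then show ?thesis using mem[OF small] pos assms(1) by blast
  next
    assume "m' < 17"
    moreover have "m' dvd n" "n div m' = m"
      using n pos by simp_all
    ultimately show ?thesis using mem[OF small, of m'] pos by simp
  qed
qed

text \<open>Reduces the inclusion to finitely many numerical tests: the order runs through the
  divisors of 24, and \<open>M = C / k\<close> through the divisors of
  \<open>N div k\<^sup>2\<close>, which inherits the bound on \<open>N\<close>.\<close>

lemma root_index_subset:
  assumes "0 < N" "N < 17\<^sup>2" "j dvd 24"
    and check: "list_all (\<lambda>k. k dvd j \<longrightarrow> k\<^sup>2 dvd N \<longrightarrow>
      list_all (\<lambda>M. (M * k, k) \<in> T) (divisor_list (N div k\<^sup>2))) [1, 2, 3, 4, 6, 8, 12, 24]"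
  shows "root_index N j \<subseteq> T"
proof
  fix x assume "x \<in> root_index N j"
  then obtain C k where "x = (C, k)" "k dvd j" "k dvd C" "C * k dvd N"
    by (auto simp: root_index_def)
  moreover from this obtain M where "C = k * M"
    by (elim dvdE)
  ultimately have x: "x = (M * k, k)" and *: "k dvd j" "M * k\<^sup>2 dvd N"
    by (simp_all add: power2_eq_square ac_simps)
  have "k dvd 24"
    using *(1) assms(3) by (rule dvd_trans)
  \<comment> \<open>These are the eight divisors of 24, obtained by the same trial division.\<close>
  then have k: "k \<in> set [1, 2, 3, 4, 6, 8, 12, 24]"
    using dvd_imp_mem_divisor_list[of k 24] by (auto simp: divisor_list_def)
  have "0 < k"
    using k by auto
  have "k\<^sup>2 dvd N"
    using *(2) by (rule dvd_mult_right)
  moreover from this \<open>0 < k\<close> have "M dvd N div k\<^sup>2"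
    using *(2) by (subst dvd_div_iff_mult) auto
  moreover have "0 < N div k\<^sup>2"
    using \<open>k\<^sup>2 dvd N\<close> \<open>0 < k\<close> assms(1) by (simp add: dvd_imp_le div_greater_zero_iff)
  moreover have "N div k\<^sup>2 < 17\<^sup>2"
    using assms(2) by (rule le_less_trans[OF div_le_dividend])
  ultimately have "M \<in> set (divisor_list (N div k\<^sup>2))"
    by (intro dvd_imp_mem_divisor_list)
  then show "x \<in> T"
    using check k *(1) \<open>k\<^sup>2 dvd N\<close> unfolding x list_all_iff by blast
qed

section \<open>Full subgraphs\<close>

lemma wf_big_picture: "wf_digraph big_picture"
  by unfold_locales (auto simp: big_picture_def)

text \<open>Restriction takes \<open>S\<close> itself as vertex set and keeps every arc with both
  ends in \<open>S\<close>; the inclusion of \<open>S\<close> in \<open>verts G\<close> makes the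
  result a subgraph.\<close>

lemma induced_subgraph_induce:
  assumes "wf_digraph G" "S \<subseteq> verts G"
  shows "induced_subgraph (G \<restriction> S) G"
proof -
  interpret wf_digraph G by (rule assms(1))
  have "subgraph (G \<restriction> S) G"
    using assms by (intro subgraphI) (auto simp: compatible_def)
  then show ?thesis
    by (intro induced_subgraphI) auto
qed

section \<open>Pictures described by an index of pairs\<close>

text \<open>Common ground for both pictures, whose properties can be read off \<open>T\<close>.
  Positivity and divisibility make \<open>C / k\<close> a positive integer, so all vertices are
  number-like; the last assumption puts the number class at the centre of each root into the
  picture.\<close>

locale root_picture =
  fixes G :: "(lattice_class, lattice_class \<times> lattice_class) pre_digraph"
    and T :: "(nat \<times> nat) set"
  assumes verts_eq: "verts G = root_classes T"
    and index_pos: "\<And>C k. (C, k) \<in> T \<Longrightarrow> 0 < C"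
    and index_dvd: "\<And>C k. (C, k) \<in> T \<Longrightarrow> k dvd C"
    and centre_in_index: "\<And>C k. (C, k) \<in> T \<Longrightarrow> (C, 1) \<in> T"
begin

lemma order_pos: "(C, k) \<in> T \<Longrightarrow> 0 < k"
  using index_dvd[of C k] index_pos[of C k] by (cases k) auto

lemma root_orders_eq: "root_orders G C = T `` {C}"
proof -
  have "h \<in> root_orders G C \<longleftrightarrow> (C, h) \<in> T" for h
    using primitive_roots_at_subset_root_classes_iff[of T h C] order_pos
    \<comment> \<open>For \<open>h = 0\<close> both sides fail: \<open>root_orders\<close> asks for
      a positive order, and all orders in \<open>T\<close> are positive.\<close>
    by (cases "0 < h") (auto simp only: root_orders_def verts_eq mem_Collect_eq)
  then show ?thesis
    by blast
qed

lemma centre_in_verts_iff: "frac_class (of_nat C) 0 1 \<in> verts G \<longleftrightarrow> (C, 1) \<in> T"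
  using frac_class_in_root_classes_iff[of T 1 0 C] order_pos by (auto simp: verts_eq)

lemma vertexE:
  assumes "X \<in> verts G"
  obtains M g k where "X = frac_class (of_nat M) g k" "0 < M" "g < k" "coprime g k"
    "(M * k, k) \<in> T"
proof -
  obtain C g k where *: "(C, k) \<in> T" "g < k" "coprime g k"
    "X = frac_class (of_nat C / of_nat k) g k"
    using assms by (auto simp: verts_eq root_classes_def primitive_roots_at_def)
  obtain M where "C = k * M"
    using index_dvd[OF *(1)] by (elim dvdE)
  then show ?thesis
    using that[of M g k] * index_pos[OF *(1)] by (simp add: mult.commute)
qed

lemma verts_number_like: "X \<in> verts G \<Longrightarrow> number_like X"
  by (elim vertexE) (auto simp: number_like_def big_picture_def picture_classes_def frac_class_def)

lemma number_classes_eq: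
  "{X \<in> verts G. number_class X} = (\<lambda>C. frac_class (of_nat C) 0 1) ` {C. (C, 1) \<in> T}"
proof (intro equalityI subsetI)
  fix X assume "X \<in> {X \<in> verts G. number_class X}"
  then have X: "X \<in> verts G" "snd X = 0"
    by (auto simp: number_class_def)
  from X(1) obtain M g k where *: "X = frac_class (of_nat M) g k" "g < k" "coprime g k"
      "(M * k, k) \<in> T"
    by (elim vertexE)
  \<comment> \<open>A vanishing second coordinate gives \<open>g = 0\<close>, and 0 is coprime only
    to \<open>k = 1\<close>.\<close>
  have "g = 0" "k = 1"
    using X(2) * by (auto simp: frac_class_def)
  then show "X \<in> (\<lambda>C. frac_class (of_nat C) 0 1) ` {C. (C, 1) \<in> T}"
    using * by auto
next
  fix X assume "X \<in> (\<lambda>C. frac_class (of_nat C) 0 1) ` {C. (C, 1) \<in> T}"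
  then obtain C where C: "X = frac_class (of_nat C) 0 1" "(C, 1) \<in> T"
    by auto
  then have "X \<in> verts G"
    by (simp only: centre_in_verts_iff)
  then show "X \<in> {X \<in> verts G. number_class X}"
    using verts_number_like C(1) by (auto simp: number_class_def frac_class_def)
qed

lemma card_number_classes: "card {X \<in> verts G. number_class X} = card {C. (C, 1) \<in> T}"
  unfolding number_classes_eq by (rule card_image) (auto simp: inj_on_def frac_class_def)

lemma root_vertex:
  assumes "X \<in> verts G" "\<not> number_class X"
  shows "\<exists>M g h::nat. 0 < M \<and> 1 < h \<and> g < h \<and> coprime g h \<and>
           X = frac_class (of_nat M) g h \<and>
           frac_class (of_nat (M * h)) 0 1 \<in> verts G \<and>
           X \<in> primitive_roots_at (M * h) h \<and>
           h \<in> root_orders G (M * h)"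
proof -
  obtain M g k where *: "X = frac_class (of_nat M) g k" "0 < M" "g < k" "coprime g k"
      "(M * k, k) \<in> T"
    using assms(1) by (elim vertexE)
  have "k \<noteq> 1"
  proof
    assume "k = 1"
    then have "snd X = 0"
      using * by (simp add: frac_class_def)
    then show False
      using assms verts_number_like by (simp add: number_class_def)
  qed
  then have "1 < k"
    using *(3) by simp
  moreover have "X \<in> primitive_roots_at (M * k) k"
    using * by (auto simp: primitive_roots_at_def)
  moreover have "frac_class (of_nat (M * k)) 0 1 \<in> verts G"
    using centre_in_index[OF *(5)] by (simp only: centre_in_verts_iff)
  moreover have "k \<in> root_orders G (M * k)"
    using *(5) by (simp add: root_orders_eq)
  ultimately show ?thesis
    using * by blast
qed

lemma card_verts:
  "finite T \<Longrightarrow> card (verts G) = (\<Sum>(C, k) \<in> T. card {g \<in> {..<k}. coprime g k})"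
  unfolding verts_eq using order_pos by (intro card_root_classes) auto

lemma verts_subset_big_picture: "verts G \<subseteq> verts big_picture"
  using verts_number_like by (auto simp: number_like_def)

end

section \<open>The index sets of the two Mathieu pictures\<close>

text \<open>There is one block for each order, whereas the theorem groups by centre. The blocks are
  then disjoint and their sizes are the multiplicities of the orders.\<close>

definition mathieu_index :: "(nat \<times> nat) set" where
  "mathieu_index =
     {1, 5, 7, 9, 11, 15, 22, 23, 28, 30, 32, 40, 46, 63, 126, 288,
      2, 10, 16, 18, 20, 144, 14, 3, 21, 42, 96, 4, 8, 36, 72, 6, 48, 12, 24} \<times> {1} \<union>
     {2, 10, 16, 18, 20, 144, 4, 8, 36, 72, 6, 48, 12, 24} \<times> {2} \<union>
     {3, 21, 42, 96, 6, 48, 12, 24} \<times> {3} \<union>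
     {4, 8, 36, 72, 12, 24} \<times> {4} \<union>
     {6, 48, 12, 24} \<times> {6} \<union>
     {12, 24} \<times> {12}"

lemma mathieu_pairs_bounds:
  "(n, h) \<in> mathieu_pairs \<Longrightarrow> 0 < n \<and> 0 < h \<and> h dvd 24 \<and> h * n < 17\<^sup>2"
  by (auto simp: mathieu_pairs_def)

text \<open>This is the premise \<open>check\<close> of \<open>root_index_subset\<close> for all 21
  pairs, with \<open>j = h\<close>.\<close>

lemma serpent_index_check:
  "\<forall>(n, h) \<in> mathieu_pairs. list_all (\<lambda>k. k dvd h \<longrightarrow> k\<^sup>2 dvd h * n \<longrightarrow>
     list_all (\<lambda>M. (M * k, k) \<in> mathieu_index) (divisor_list (h * n div k\<^sup>2)))
     [1, 2, 3, 4, 6, 8, 12, 24]"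
  \<comment> \<open>Unfolding in stages lets the divisibility tests on \<open>k\<close> be decided
    before divisor lists are expanded, and these before membership in the index is tested.\<close>
  apply (simp add: mathieu_pairs_def)
  apply (simp add: divisor_list_def)
  apply (simp add: mathieu_index_def)
  done

text \<open>Orders may now be any divisor of 24. The one new pair \<open>(14, 2)\<close> comes from
  level 28 with \<open>k = 2\<close> and \<open>M = 7\<close>; the serpent of \<open>(28, 1)\<close>
  admits order 1 only.\<close>

lemma snake_index_check:
  "\<forall>(n, h) \<in> mathieu_pairs. list_all (\<lambda>k. k dvd 24 \<longrightarrow> k\<^sup>2 dvd h * n \<longrightarrow>
     list_all (\<lambda>M. (M * k, k) \<in> insert (14, 2) mathieu_index) (divisor_list (h * n div k\<^sup>2)))
     [1, 2, 3, 4, 6, 8, 12, 24]"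
  apply (simp add: mathieu_pairs_def)
  apply (simp add: divisor_list_def)
  apply (simp add: mathieu_index_def)
  done

text \<open>Gives the converse inclusion: every listed pair occurs in some serpent.\<close>

lemma mathieu_index_attained:
  "\<forall>(C, k) \<in> mathieu_index. \<exists>(n, h) \<in> mathieu_pairs. k dvd h \<and> k dvd C \<and> C * k dvd h * n"
  by (simp add: mathieu_index_def mathieu_pairs_def)

lemma serpent_index: "(\<Union>(n, h) \<in> mathieu_pairs. root_index (h * n) h) = mathieu_index"
proof
  have "root_index (h * n) h \<subseteq> mathieu_index" if "(n, h) \<in> mathieu_pairs" for n h
    using mathieu_pairs_bounds[OF that] bspec[OF serpent_index_check that]
    by (intro root_index_subset) auto
  then show "(\<Union>(n, h) \<in> mathieu_pairs. root_index (h * n) h) \<subseteq> mathieu_index"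
    by blast
  show "mathieu_index \<subseteq> (\<Union>(n, h) \<in> mathieu_pairs. root_index (h * n) h)"
  proof
    fix x assume "x \<in> mathieu_index"
    then obtain C k n h where "x = (C, k)" "(n, h) \<in> mathieu_pairs"
        "k dvd h" "k dvd C" "C * k dvd h * n"
      using mathieu_index_attained by blast
    moreover from this have "x \<in> root_index (h * n) h"
      by (simp add: root_index_def)
    ultimately show "x \<in> (\<Union>(n, h) \<in> mathieu_pairs. root_index (h * n) h)"
      by blast
  qed
qed

lemma snake_index:
  "(\<Union>(n, h) \<in> mathieu_pairs. root_index (h * n) 24) = insert (14, 2) mathieu_index"
proof
  have "root_index (h * n) 24 \<subseteq> insert (14, 2) mathieu_index" if "(n, h) \<in> mathieu_pairs" for n h
    using mathieu_pairs_bounds[OF that] bspec[OF snake_index_check that]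
    by (intro root_index_subset) auto
  then show "(\<Union>(n, h) \<in> mathieu_pairs. root_index (h * n) 24) \<subseteq> insert (14, 2) mathieu_index"
    by blast
  \<comment> \<open>Since \<open>h\<close> divides 24, each serpent lies inside the snake of the
    same level.\<close>
  have "root_index (h * n) h \<subseteq> root_index (h * n) 24" if "(n, h) \<in> mathieu_pairs" for n h
    using mathieu_pairs_bounds[OF that] by (auto simp: root_index_def intro: dvd_trans)
  then have "mathieu_index \<subseteq> (\<Union>(n, h) \<in> mathieu_pairs. root_index (h * n) 24)"
    unfolding serpent_index[symmetric] by blast
  moreover have "(14, 2) \<in> root_index (1 * 28) 24" "(28, 1) \<in> mathieu_pairs"
    by (simp_all add: root_index_def mathieu_pairs_def)
  ultimately show "insert (14, 2) mathieu_index \<subseteq> (\<Union>(n, h) \<in> mathieu_pairs. root_index (h * n) 24)"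
    by blast
qed

lemma root_classes_UN: "root_classes (\<Union>i \<in> I. T i) = (\<Union>i \<in> I. root_classes (T i))"
  by (auto simp: root_classes_def)

lemma verts_mathieu_picture: "verts mathieu_picture = root_classes mathieu_index"
proof -
  have "verts (serpent n h) = root_classes (root_index (h * n) h)" if "(n, h) \<in> mathieu_pairs" for n h
    using mathieu_pairs_bounds[OF that] by (simp add: serpent_def root_classes_root_index)
  then show ?thesis
    by (auto simp: mathieu_picture_def serpent_index[symmetric] root_classes_UN)
qed

lemma verts_extended_mathieu_picture:
  "verts extended_mathieu_picture = root_classes (insert (14, 2) mathieu_index)"
proof -
  have "verts (snake (h * n)) = root_classes (root_index (h * n) 24)" if "(n, h) \<in> mathieu_pairs" for n h
    using mathieu_pairs_bounds[OF that] by (simp add: snake_def root_classes_root_index)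
  then show ?thesis
    by (auto simp: extended_mathieu_picture_def snake_index[symmetric] root_classes_UN)
qed

interpretation serpents: root_picture mathieu_picture mathieu_index
  by unfold_locales (simp add: verts_mathieu_picture, auto simp: mathieu_index_def)

interpretation snakes: root_picture extended_mathieu_picture "insert (14, 2) mathieu_index"
  by unfold_locales (simp add: verts_extended_mathieu_picture, auto simp: mathieu_index_def)

section \<open>Counting classes and listing orders\<close>

lemma finite_mathieu_index: "finite mathieu_index"
  by (simp add: mathieu_index_def)

text \<open>The coefficients are the sizes of the six blocks, that is, the number of centres
  carrying each order.\<close>

lemma sum_mathieu_index:
  fixes f :: "nat \<Rightarrow> nat"
  shows "(\<Sum>(C, k) \<in> mathieu_index. f k) =
    35 * f 1 + 14 * f 2 + 8 * f 3 + 6 * f 4 + 4 * f 6 + 2 * f 12"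
proof -
  have S: "(\<Sum>(C, k) \<in> A \<times> {m}. f k) = card A * f m" if "finite A" for A :: "nat set" and m
    by (simp add: sum.cartesian_product[symmetric])
  show ?thesis
    unfolding mathieu_index_def
    \<comment> \<open>Splits off one block after another; blocks are disjoint because their orders
      differ.\<close>
    apply (subst sum.union_disjoint, simp, simp, force)+
    apply (subst S, simp)+
    apply simp
    done
qed

lemma coprime_residues:
  "{g \<in> {..<1}. coprime g (1::nat)} = {0}"
  "{g \<in> {..<2}. coprime g (2::nat)} = {1}"
  "{g \<in> {..<3}. coprime g (3::nat)} = {1, 2}"
  "{g \<in> {..<4}. coprime g (4::nat)} = {1, 3}"
  "{g \<in> {..<6}. coprime g (6::nat)} = {1, 5}"
  "{g \<in> {..<12}. coprime g (12::nat)} = {1, 5, 7, 11}"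
  by code_simp+

text \<open>With totients 1, 1, 2, 2, 2, 4 the sum is \<open>35 + 14 + 16 + 12 + 8 + 8\<close>. The
  pair \<open>(14, 2)\<close> adds a single class, 7 with fraction 1/2.\<close>

lemma order_counts:
  "(\<Sum>(C, k) \<in> mathieu_index. card {g \<in> {..<k}. coprime g k}) = 93"
  "(\<Sum>(C, k) \<in> insert (14, 2) mathieu_index. card {g \<in> {..<k}. coprime g k}) = 94"
proof -
  show *: "(\<Sum>(C, k) \<in> mathieu_index. card {g \<in> {..<k}. coprime g k}) = 93"
    unfolding sum_mathieu_index coprime_residues by simp
  have notin: "(14, 2) \<notin> mathieu_index"
    by (simp add: mathieu_index_def)
  show "(\<Sum>(C, k) \<in> insert (14, 2) mathieu_index. card {g \<in> {..<k}. coprime g k}) = 94"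
    unfolding sum.insert[OF finite_mathieu_index notin] prod.case * coprime_residues by simp
qed

lemma mathieu_index_orders:
  "\<forall>C \<in> {1, 5, 7, 9, 11, 15, 22, 23, 28, 30, 32, 40, 46, 63, 126, 288}.
     mathieu_index `` {C} = {1} \<and>
     insert (14, 2) mathieu_index `` {C} = {1}"
  "\<forall>C \<in> {2, 10, 16, 18, 20, 144}.
     mathieu_index `` {C} = {1, 2} \<and>
     insert (14, 2) mathieu_index `` {C} = {1, 2}"
  "mathieu_index `` {14} = {1} \<and>
     insert (14, 2) mathieu_index `` {14} = {1, 2}"
  "\<forall>C \<in> {3, 21, 42, 96}.
     mathieu_index `` {C} = {1, 3} \<and>
     insert (14, 2) mathieu_index `` {C} = {1, 3}"
  "\<forall>C \<in> {4, 8, 36, 72}.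
     mathieu_index `` {C} = {1, 2, 4} \<and>
     insert (14, 2) mathieu_index `` {C} = {1, 2, 4}"
  "\<forall>C \<in> {6, 48}.
     mathieu_index `` {C} = {1, 2, 3, 6} \<and>
     insert (14, 2) mathieu_index `` {C} = {1, 2, 3, 6}"
  "\<forall>C \<in> {12, 24}.
     mathieu_index `` {C} = {1, 2, 3, 4, 6, 12} \<and>
     insert (14, 2) mathieu_index `` {C} = {1, 2, 3, 4, 6, 12}"
  by (simp_all add: mathieu_index_def Image_def) blast+

theorem theorem4:
  shows "induced_subgraph mathieu_picture big_picture \<and>
         card (verts mathieu_picture) = 93 \<and>
         induced_subgraph extended_mathieu_picture big_picture \<and>
         card (verts extended_mathieu_picture) = 94 \<and>
         (\<forall>G \<in> {mathieu_picture, extended_mathieu_picture}.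
           card {X \<in> verts G. number_class X} = 35 \<and>
           {C::nat. 0 < C \<and> frac_class (of_nat C) 0 1 \<in> verts G} =
             {1, 5, 7, 9, 11, 15, 22, 23, 28, 30, 32, 40, 46, 63, 126, 288} \<union>
             {2, 10, 16, 18, 20, 144} \<union> {14} \<union> {3, 21, 42, 96} \<union>
             {4, 8, 36, 72} \<union> {6, 48} \<union> {12, 24} \<and>
           (\<forall>X \<in> verts G. \<not> number_class X \<longrightarrow>
              number_like X \<and>
              (\<exists>M g h::nat. 0 < M \<and> 1 < h \<and> g < h \<and> coprime g h \<and>
                 X = frac_class (of_nat M) g h \<and>
                 frac_class (of_nat (M * h)) 0 1 \<in> verts G \<and>
                 X \<in> primitive_roots_at (M * h) h \<and>
                 h \<in> root_orders G (M * h)))) \<and>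
         (\<forall>C \<in> {1, 5, 7, 9, 11, 15, 22, 23, 28, 30, 32, 40, 46, 63, 126, 288}.
           root_orders mathieu_picture C = {1} \<and>
           root_orders extended_mathieu_picture C = {1}) \<and>
         (\<forall>C \<in> {2, 10, 16, 18, 20, 144}.
           root_orders mathieu_picture C = {1, 2} \<and>
           root_orders extended_mathieu_picture C = {1, 2}) \<and>
         (root_orders mathieu_picture 14 = {1} \<and>
         root_orders extended_mathieu_picture 14 = {1, 2}) \<and>
         (\<forall>C \<in> {3, 21, 42, 96}.
           root_orders mathieu_picture C = {1, 3} \<and>
           root_orders extended_mathieu_picture C = {1, 3}) \<and>
         (\<forall>C \<in> {4, 8, 36, 72}.
           root_orders mathieu_picture C = {1, 2, 4} \<and>
           root_orders extended_mathieu_picture C = {1, 2, 4}) \<and>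
         (\<forall>C \<in> {6, 48}.
           root_orders mathieu_picture C = {1, 2, 3, 6} \<and>
           root_orders extended_mathieu_picture C = {1, 2, 3, 6}) \<and>
         (\<forall>C \<in> {12, 24}.
           root_orders mathieu_picture C = {1, 2, 3, 4, 6, 12} \<and>
           root_orders extended_mathieu_picture C = {1, 2, 3, 4, 6, 12})"
proof -
  let ?numbers = "{1, 5, 7, 9, 11, 15, 22, 23, 28, 30, 32, 40, 46, 63, 126, 288} \<union>
    {2, 10, 16, 18, 20, 144} \<union> {14} \<union> {3, 21, 42, 96} \<union>
    {4, 8, 36, 72} \<union> {6, 48} \<union> {12, 24} :: nat set"
  \<comment> \<open>The extra pair \<open>(14, 2)\<close> has order 2, so it leaves the set of
    number classes unchanged.\<close>
  have centres: "{C. (C, 1) \<in> mathieu_index} = ?numbers"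
    "{C. (C, 1) \<in> insert (14, 2) mathieu_index} = ?numbers"
    by (auto simp: mathieu_index_def)
  have counts: "card (verts mathieu_picture) = 93" "card (verts extended_mathieu_picture) = 94"
    using serpents.card_verts snakes.card_verts finite_mathieu_index order_counts by simp_all
  have induced: "induced_subgraph mathieu_picture big_picture"
    "induced_subgraph extended_mathieu_picture big_picture"
    using induced_subgraph_induce[OF wf_big_picture] serpents.verts_subset_big_picture
      snakes.verts_subset_big_picture
    by (simp_all add: mathieu_picture_def extended_mathieu_picture_def)
  have numbers: "\<forall>G \<in> {mathieu_picture, extended_mathieu_picture}.
      card {X \<in> verts G. number_class X} = 35 \<and>
      {C::nat. 0 < C \<and> frac_class (of_nat C) 0 1 \<in> verts G} = ?numbers \<and>
      (\<forall>X \<in> verts G. \<not> number_class X \<longrightarrow> number_like X \<and>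
        (\<exists>M g h::nat. 0 < M \<and> 1 < h \<and> g < h \<and> coprime g h \<and>
           X = frac_class (of_nat M) g h \<and> frac_class (of_nat (M * h)) 0 1 \<in> verts G \<and>
           X \<in> primitive_roots_at (M * h) h \<and> h \<in> root_orders G (M * h)))"
  proof
    fix G assume "G \<in> {mathieu_picture, extended_mathieu_picture}"
    then obtain T where "root_picture G T" and T: "{C. (C, 1) \<in> T} = ?numbers"
      using serpents.root_picture_axioms snakes.root_picture_axioms centres by blast
    interpret root_picture G T by fact
    have "card {X \<in> verts G. number_class X} = 35"
      unfolding card_number_classes T by simp
    moreover have "{C::nat. 0 < C \<and> frac_class (of_nat C) 0 1 \<in> verts G} = ?numbers"
      \<comment> \<open>Centres in the index are positive, which supplies the conjunct
        \<open>0 < C\<close>.\<close>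
      unfolding centre_in_verts_iff T[symmetric] using index_pos by blast
    moreover have "\<forall>X \<in> verts G. \<not> number_class X \<longrightarrow> number_like X \<and>
        (\<exists>M g h::nat. 0 < M \<and> 1 < h \<and> g < h \<and> coprime g h \<and>
           X = frac_class (of_nat M) g h \<and> frac_class (of_nat (M * h)) 0 1 \<in> verts G \<and>
           X \<in> primitive_roots_at (M * h) h \<and> h \<in> root_orders G (M * h))"
      using verts_number_like root_vertex by (intro ballI impI conjI)
    ultimately show "card {X \<in> verts G. number_class X} = 35 \<and>
      {C::nat. 0 < C \<and> frac_class (of_nat C) 0 1 \<in> verts G} = ?numbers \<and>
      (\<forall>X \<in> verts G. \<not> number_class X \<longrightarrow> number_like X \<and>
        (\<exists>M g h::nat. 0 < M \<and> 1 < h \<and> g < h \<and> coprime g h \<and>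
           X = frac_class (of_nat M) g h \<and> frac_class (of_nat (M * h)) 0 1 \<in> verts G \<and>
           X \<in> primitive_roots_at (M * h) h \<and> h \<in> root_orders G (M * h)))"
      by (intro conjI)
  qed
  \<comment> \<open>Read from right to left, \<open>root_orders_eq\<close> turns the tabulated
    fibres of the index into sets of root orders.\<close>
  note orders = mathieu_index_orders[folded serpents.root_orders_eq snakes.root_orders_eq]
  show ?thesis
    by (intro conjI counts induced numbers orders(1,2,4-7)
        orders(3)[THEN conjunct1] orders(3)[THEN conjunct2])
qed

end
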